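(* Let $\mathbf{M}$ be the invertible $(N+1)\times(N+1)$ matrix with $Q(x)=\mathbf{M}X(x)$ and $X(x)=\mathbf{M}^{-1}Q(x)$. Let $L$ be the $(N+1)\times(N+1)$ matrix with $$\int_a^x X(t)\,dt\simeq L\,X(x),$$ and let $\mathbf{I}$ be the $(N+1)\times(N+1)$ matrix with $$\int_a^x Q(t)\,dt\simeq \mathbf{I}\,Q(x)$$ (the operational matrix of integral of $Q$). Then $$\mathbf{I}=\mathbf{M}L\mathbf{M}^{-1}.$$
   Context: Fix real numbers $a<b$ and a natural number $N$. For $n=0,1,\dots,N$, the Bessel polynomials are $$B_n(x)=\sum_{r=0}^{\lfloor (N-n)/2\rfloor}\frac{(-1)^r}{r!\,(n+r)!}\left(\frac{x}{2}\right)^{2r+n},$$ and the shifted Bessel polynomials on $[a,b]$ are $Q_n(x)=B_n\left(\frac{x-a}{b-a}\right)$, $x\in[a,b]$. Put $Q(x)=[Q_0(x),\dots,Q_N(x)]^T$, $X(x)=[1,x,\dots,x^N]^T$ and $\mathfrak{Q}_N=\operatorname{span}\{Q_0,\dots,Q_N\}$. The matrix $\mathbf{M}$ is the constant real change-of-basis matrix expressing the $Q_n$ in the monomials $1,x,\dots,x^N$; it is invertible. On $L^2_w([a,b])$ with $w(x)=\frac1{b-a}$ use the inner product $\langle v,u\rangle_w=\int_a^b v(x)u(x)w(x)\,dx$. For vectors of functions $g=(g_0,\dots,g_N)^T$ with $g_i\in L^2_w([a,b])$ and $h=(h_0,\dots,h_N)^T$ with $h_i\in\mathfrak{Q}_N$,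 the notation $g\simeq h$ means that for each $i$, $h_i$ is the best approximation to $g_i$ from $\mathfrak{Q}_N$ in the norm of $L^2_w([a,b])$, i.e. $h_i$ is the orthogonal projection of $g_i$ onto $\mathfrak{Q}_N$. Explicitly, with indices $i,j=0,\dots,N$: for $i<N$, $L_{i,i+1}=\frac1{i+1}$, $L_{i,0}=-\frac{a^{i+1}}{i+1}$ and all other entries of row $i$ are $0$; row $N$ of $L$ consists of the coefficients with respect to $1,x,\dots,x^N$ of the best approximation of $\frac{x^{N+1}-a^{N+1}}{N+1}$ from $\mathfrak{Q}_N$. *)

theory Defs
  imports "HOL-Analysis.Analysis" "Jordan_Normal_Form.Matrix"
begin

text \<open>From here on \<open>$\<close> is component access for the vectors of \<^theory>\<open>Jordan_Normal_Form.Matrix\<close>.\<close>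

unbundle no vec_syntax

text \<open>The truncation order depends on \<open>N\<close>, and the index is meant to satisfy \<open>n \<le> N\<close>, so that
  the natural-number subtraction is the true one.\<close>

definition bessel_poly :: "nat \<Rightarrow> nat \<Rightarrow> real \<Rightarrow> real" where
  "bessel_poly N n x =
     (\<Sum>r = 0..(N - n) div 2. (-1) ^ r / (fact r * fact (n + r)) * (x / 2) ^ (2 * r + n))"

definition shifted_bessel :: "real \<Rightarrow> real \<Rightarrow> nat \<Rightarrow> nat \<Rightarrow> real \<Rightarrow> real" where
  "shifted_bessel a b N n x = bessel_poly N n ((x - a) / (b - a))"

definition bessel_vec :: "real \<Rightarrow> real \<Rightarrow> nat \<Rightarrow> real \<Rightarrow> real vec" where
  "bessel_vec a b N x = vec (N + 1) (\<lambda>n. shifted_bessel a b N n x)"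

definition monom_vec :: "nat \<Rightarrow> real \<Rightarrow> real vec" where
  "monom_vec N x = vec (N + 1) (\<lambda>i. x ^ i)"

text \<open>Functions on \<open>[a,b]\<close> are represented by total functions of which only the values on
  \<open>{a..b}\<close> matter; hence membership in the span is required on \<open>{a..b}\<close> only.\<close>

definition bessel_span :: "real \<Rightarrow> real \<Rightarrow> nat \<Rightarrow> (real \<Rightarrow> real) set" where
  "bessel_span a b N =
     {f. \<exists>c :: nat \<Rightarrow> real. \<forall>x\<in>{a..b}. f x = (\<Sum>n = 0..N. c n * shifted_bessel a b N n x)}"

definition weight :: "real \<Rightarrow> real \<Rightarrow> real \<Rightarrow> real" where
  "weight a b x = 1 / (b - a)"

definition L2w :: "real \<Rightarrow> real \<Rightarrow> (real \<Rightarrow> real) set" where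
  "L2w a b = {f \<in> borel_measurable (lebesgue_on {a..b}).
     integrable (lebesgue_on {a..b}) (\<lambda>x. (f x)\<^sup>2 * weight a b x)}"

definition inner_w :: "real \<Rightarrow> real \<Rightarrow> (real \<Rightarrow> real) \<Rightarrow> (real \<Rightarrow> real) \<Rightarrow> real" where
  "inner_w a b v u = (\<integral>x. v x * u x * weight a b x \<partial>lebesgue_on {a..b})"

definition norm_w :: "real \<Rightarrow> real \<Rightarrow> (real \<Rightarrow> real) \<Rightarrow> real" where
  "norm_w a b f = sqrt (inner_w a b f f)"

definition best_approx :: "real \<Rightarrow> real \<Rightarrow> nat \<Rightarrow> (real \<Rightarrow> real) \<Rightarrow> (real \<Rightarrow> real) \<Rightarrow> bool" where
  "best_approx a b N g h \<longleftrightarrow>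
     g \<in> L2w a b \<and> h \<in> bessel_span a b N \<and>
     (\<forall>u\<in>bessel_span a b N. norm_w a b (\<lambda>x. g x - h x) \<le> norm_w a b (\<lambda>x. g x - u x))"

text \<open>The relation \<open>g \<simeq> h\<close> between vectors of functions.\<close>

definition best_approx_vec ::
    "real \<Rightarrow> real \<Rightarrow> nat \<Rightarrow> (real \<Rightarrow> real vec) \<Rightarrow> (real \<Rightarrow> real vec) \<Rightarrow> bool" where
  "best_approx_vec a b N g h \<longleftrightarrow>
     (\<forall>i\<le>N. best_approx a b N (\<lambda>x. g x $ i) (\<lambda>x. h x $ i))"

definition integral_vec :: "real \<Rightarrow> nat \<Rightarrow> (real \<Rightarrow> real vec) \<Rightarrow> real \<Rightarrow> real vec" where
  "integral_vec a N F x = vec (N + 1) (\<lambda>i. \<integral>t. F t $ i \<partial>lebesgue_on {a..x})"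

end

theory Submission imports Defs begin

text \<open>The residual of a best approximation is orthogonal to the span of the \<open>Q\<^sub>n\<close>.
  Integration is linear, so the residuals of the monomials, combined with the coefficients of row
  \<open>n\<close> of \<open>M\<close>, differ from the residual of \<open>Q\<^sub>n\<close> by the \<open>n\<close>-th entry of
  \<open>I Q - M L X = (I M - M L) X\<close>. This entry lies in the span and is orthogonal to it, hence vanishes
  on \<open>[a,b]\<close>; comparing coefficients gives \<open>I M = M L\<close>.\<close>

section \<open>Weighted square-integrable functions\<close>

lemma continuous_on_imp_L2w:
  assumes "continuous_on {a..b} f"
  shows "f \<in> L2w a b"
proof -
  have "continuous_on {a..b} (\<lambda>x. (f x)\<^sup>2 * weight a b x)"
    unfolding weight_def divide_inverse by (intro continuous_intros assms)
  then have "integrable (lebesgue_on {a..b}) (\<lambda>x. (f x)\<^sup>2 * weight a b x)"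
    by (rule continuous_imp_integrable_real)
  moreover have "f \<in> borel_measurable (lebesgue_on {a..b})"
    using continuous_imp_measurable_on_sets_lebesgue[OF assms] by simp
  ultimately show ?thesis
    by (simp add: L2w_def)
qed

text \<open>Domination: \<open>\<bar>f x * g x\<bar>\<close> is at most the sum of the two squares,
  each of which is integrable against the weight; \<open>a < b\<close> makes the weight
  positive.\<close>

lemma integrable_L2w_mult:
  assumes "a < b" "f \<in> L2w a b" "g \<in> L2w a b"
  shows "integrable (lebesgue_on {a..b}) (\<lambda>x. f x * g x * weight a b x)"
proof (rule Bochner_Integration.integrable_bound)
  show "integrable (lebesgue_on {a..b}) (\<lambda>x. (f x)\<^sup>2 * weight a b x + (g x)\<^sup>2 * weight a b x)"
    using assms by (simp add: L2w_def)
  show "(\<lambda>x. f x * g x * weight a b x) \<in> borel_measurable (lebesgue_on {a..b})"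
    using assms unfolding L2w_def weight_def by auto
  have "\<bar>f x * g x\<bar> \<le> (f x)\<^sup>2 + (g x)\<^sup>2" for x
  proof -
    have "2 * (\<bar>f x\<bar> * \<bar>g x\<bar>) \<le> (f x)\<^sup>2 + (g x)\<^sup>2"
      using sum_squares_bound[of "\<bar>f x\<bar>" "\<bar>g x\<bar>"] by (simp add: mult.assoc)
    moreover have "0 \<le> \<bar>f x\<bar> * \<bar>g x\<bar>"
      by simp
    ultimately show ?thesis
      unfolding abs_mult by linarith
  qed
  then have "\<bar>f x * g x\<bar> * weight a b x \<le> ((f x)\<^sup>2 + (g x)\<^sup>2) * weight a b x" for x
    using assms(1) by (intro mult_right_mono) (auto simp: weight_def)
  then show "AE x in lebesgue_on {a..b}. norm (f x * g x * weight a b x)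
      \<le> norm ((f x)\<^sup>2 * weight a b x + (g x)\<^sup>2 * weight a b x)"
    using assms(1) by (intro AE_I2) (simp add: weight_def abs_mult add_divide_distrib)
qed

lemma L2w_cmult: "f \<in> L2w a b \<Longrightarrow> (\<lambda>x. c * f x) \<in> L2w a b"
  unfolding L2w_def by (auto simp: power_mult_distrib mult.assoc)

lemma L2w_diff:
  assumes "a < b" "f \<in> L2w a b" "g \<in> L2w a b"
  shows "(\<lambda>x. f x - g x) \<in> L2w a b"
proof -
  \<comment> \<open>This is the expanded square of the difference; its cross term is integrable as a
    product of two members of \<open>L2w\<close>.\<close>
  have "integrable (lebesgue_on {a..b})
      (\<lambda>x. (f x)\<^sup>2 * weight a b x + (g x)\<^sup>2 * weight a b x - 2 * (f x * g x * weight a b x))"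
    using assms integrable_L2w_mult[OF assms] by (simp add: L2w_def)
  then have "integrable (lebesgue_on {a..b}) (\<lambda>x. (f x - g x)\<^sup>2 * weight a b x)"
    by (simp add: power2_diff algebra_simps)
  then show ?thesis
    using assms by (auto simp: L2w_def)
qed

section \<open>The weighted inner product\<close>

lemma inner_w_commute: "inner_w a b f g = inner_w a b g f"
  by (simp add: inner_w_def mult.commute)

text \<open>Needed because identities between the represented functions are available on
  \<open>{a..b}\<close> only, which is exactly the space of the measure.\<close>

lemma inner_w_cong:
  assumes "\<And>x. x \<in> {a..b} \<Longrightarrow> f x = f' x"
  shows "inner_w a b f g = inner_w a b f' g"
  unfolding inner_w_def
  by (rule Bochner_Integration.integral_cong) (use assms in auto)

lemma inner_w_diff_left:
  assumes "a < b" "f \<in> L2w a b" "g \<in> L2w a b" "h \<in> L2w a b"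
  shows "inner_w a b (\<lambda>x. f x - g x) h = inner_w a b f h - inner_w a b g h"
  unfolding inner_w_def
  using integrable_L2w_mult[OF assms(1,2,4)] integrable_L2w_mult[OF assms(1,3,4)]
  by (simp add: left_diff_distrib)

lemma inner_w_cmult_left: "inner_w a b (\<lambda>x. c * f x) g = c * inner_w a b f g"
  unfolding inner_w_def by (simp add: mult.assoc)

lemma inner_w_sum_left:
  assumes "a < b" "\<And>j. j \<in> A \<Longrightarrow> f j \<in> L2w a b" "g \<in> L2w a b"
  shows "inner_w a b (\<lambda>x. \<Sum>j\<in>A. c j * f j x) g = (\<Sum>j\<in>A. c j * inner_w a b (f j) g)"
proof -
  have "inner_w a b (\<lambda>x. \<Sum>j\<in>A. c j * f j x) g
      = (\<integral>x. (\<Sum>j\<in>A. c j * (f j x * g x * weight a b x)) \<partial>lebesgue_on {a..b})"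
    unfolding inner_w_def by (simp add: sum_distrib_right mult.assoc)
  also have "\<dots> = (\<Sum>j\<in>A. \<integral>x. c j * (f j x * g x * weight a b x) \<partial>lebesgue_on {a..b})"
    using integrable_L2w_mult[OF assms(1) assms(2) assms(3)]
    by (intro Bochner_Integration.integral_sum integrable_mult_right) auto
  finally show ?thesis
    by (simp add: inner_w_def)
qed

lemma L2w_sum:
  assumes "a < b" "finite A" "\<And>j. j \<in> A \<Longrightarrow> f j \<in> L2w a b"
  shows "(\<lambda>x. \<Sum>j\<in>A. c j * f j x) \<in> L2w a b"
  using assms(2,3)
proof (induction A rule: finite_induct)
  case empty
  show ?case by (simp add: L2w_def)
next
  case (insert i A)
  \<comment> \<open>The factor \<open>-1\<close> turns the sum into a difference, so that closure
    under differences applies.\<close>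
  have "(\<lambda>x. c i * f i x - (-1) * (\<Sum>j\<in>A. c j * f j x)) \<in> L2w a b"
    using insert by (intro L2w_diff[OF assms(1)] L2w_cmult) auto
  with insert show ?case by simp
qed

lemma inner_w_self_nonneg:
  assumes "a < b"
  shows "0 \<le> inner_w a b f f"
  unfolding inner_w_def using assms
  by (intro Bochner_Integration.integral_nonneg) (auto simp: weight_def)

text \<open>A nonnegative continuous function with integral zero vanishes at every point. Continuity
  is what upgrades vanishing almost everywhere to vanishing everywhere on
  \<open>{a..b}\<close>.\<close>

lemma inner_w_self_eq_0:
  assumes "a < b" "continuous_on {a..b} f" "inner_w a b f f = 0" "x \<in> {a..b}"
  shows "f x = 0"
proof -
  have cont: "continuous_on {a..b} (\<lambda>x. f x * f x * weight a b x)"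
    unfolding weight_def divide_inverse by (intro continuous_intros assms)
  have "integral {a..b} (\<lambda>x. f x * f x * weight a b x) = 0"
    using assms(3) lebesgue_integral_eq_integral[OF continuous_imp_integrable_real[OF cont]]
    unfolding inner_w_def by simp
  then have "f x * f x * weight a b x = 0"
    using integral_eq_0_iff[OF cont assms(1)] assms(1,4) by (simp add: weight_def)
  then show ?thesis
    using assms(1) by (simp add: weight_def)
qed

section \<open>The span of the shifted Bessel polynomials and best approximation from it\<close>

lemma bessel_span_continuous_on:
  assumes "f \<in> bessel_span a b N"
  shows "continuous_on {a..b} f"
proof -
  obtain c where c: "\<And>x. x \<in> {a..b} \<Longrightarrow> f x = (\<Sum>n = 0..N. c n * shifted_bessel a b N n x)"
    using assms unfolding bessel_span_def by blast
  have "continuous_on {a..b} (\<lambda>x. \<Sum>n = 0..N. c n * shifted_bessel a b N n x)"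
    unfolding shifted_bessel_def bessel_poly_def divide_inverse by (intro continuous_intros)
  then show ?thesis
    by (simp add: c cong: continuous_on_cong_simp)
qed

lemma bessel_span_imp_L2w: "f \<in> bessel_span a b N \<Longrightarrow> f \<in> L2w a b"
  by (intro continuous_on_imp_L2w bessel_span_continuous_on)

lemma bessel_span_cmult:
  assumes "f \<in> bessel_span a b N"
  shows "(\<lambda>x. k * f x) \<in> bessel_span a b N"
proof -
  obtain c where c: "\<forall>x\<in>{a..b}. f x = (\<Sum>n = 0..N. c n * shifted_bessel a b N n x)"
    using assms unfolding bessel_span_def by blast
  show ?thesis
    unfolding bessel_span_def mem_Collect_eq
    by (rule exI[of _ "\<lambda>n. k * c n"]) (simp add: c sum_distrib_left mult.assoc)
qed

lemma bessel_span_add: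
  assumes "f \<in> bessel_span a b N" "g \<in> bessel_span a b N"
  shows "(\<lambda>x. f x + g x) \<in> bessel_span a b N"
proof -
  obtain c where c: "\<forall>x\<in>{a..b}. f x = (\<Sum>n = 0..N. c n * shifted_bessel a b N n x)"
    using assms unfolding bessel_span_def by blast
  obtain d where d: "\<forall>x\<in>{a..b}. g x = (\<Sum>n = 0..N. d n * shifted_bessel a b N n x)"
    using assms unfolding bessel_span_def by blast
  show ?thesis
    unfolding bessel_span_def mem_Collect_eq
    by (rule exI[of _ "\<lambda>n. c n + d n"]) (simp add: c d sum.distrib distrib_right)
qed

lemma bessel_span_diff:
  assumes "f \<in> bessel_span a b N" "g \<in> bessel_span a b N"
  shows "(\<lambda>x. f x - g x) \<in> bessel_span a b N"
  using bessel_span_add[OF assms(1) bessel_span_cmult[OF assms(2), of "-1"]] by simp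

lemma bessel_span_sum:
  assumes "finite A" "\<And>j. j \<in> A \<Longrightarrow> f j \<in> bessel_span a b N"
  shows "(\<lambda>x. \<Sum>j\<in>A. c j * f j x) \<in> bessel_span a b N"
  using assms
proof (induction A rule: finite_induct)
  case empty
  show ?case
    unfolding bessel_span_def by (auto intro: exI[of _ "\<lambda>_. 0"])
next
  case (insert i A)
  then show ?case
    by (simp add: bessel_span_add bessel_span_cmult)
qed

text \<open>Variational argument: moving \<open>h\<close> along \<open>u\<close> by any real
  multiple \<open>t\<close> cannot decrease the norm of the residual. The resulting quadratic
  inequality in \<open>t\<close> forces its linear coefficient, the inner product in question, to be
  zero.\<close>

lemma best_approx_orthogonal:
  assumes "a < b" "best_approx a b N g h" "u \<in> bessel_span a b N"
  shows "inner_w a b (\<lambda>x. g x - h x) u = 0"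
proof -
  define r where "r = (\<lambda>x. g x - h x)"
  define p q where "p = inner_w a b r u" and "q = inner_w a b u u"
  have h: "h \<in> bessel_span a b N"
    and min: "\<And>v. v \<in> bessel_span a b N \<Longrightarrow>
      norm_w a b r \<le> norm_w a b (\<lambda>x. g x - v x)"
    using assms(2) by (auto simp: best_approx_def r_def)
  have r: "r \<in> L2w a b"
    unfolding r_def using assms h bessel_span_imp_L2w[OF h]
    by (intro L2w_diff) (auto simp: best_approx_def)
  have u: "u \<in> L2w a b"
    by (rule bessel_span_imp_L2w[OF assms(3)])
  have "0 \<le> q"
    unfolding q_def by (rule inner_w_self_nonneg[OF assms(1)])
  have key: "2 * t * p \<le> t\<^sup>2 * q" for t
  proof -
    let ?s = "\<lambda>x. r x - t * u x"
    have tu: "(\<lambda>x. t * u x) \<in> L2w a b"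
      by (rule L2w_cmult[OF u])
    have s: "?s \<in> L2w a b"
      by (rule L2w_diff[OF assms(1) r tu])
    \<comment> \<open>The competitor is \<open>h + t * u\<close>, whose residual is
      \<open>r - t * u\<close>.\<close>
    have "norm_w a b r \<le> norm_w a b ?s"
      using min[OF bessel_span_add[OF h bessel_span_cmult[OF assms(3), of t]]]
      by (simp add: r_def algebra_simps)
    then have "inner_w a b r r \<le> inner_w a b ?s ?s"
      by (simp add: norm_w_def)
    \<comment> \<open>Linearity is applied in the left argument; symmetry then brings the other
      argument to the left for the second expansion.\<close>
    also have "\<dots> = inner_w a b ?s r - t * inner_w a b ?s u"
      unfolding inner_w_diff_left[OF assms(1) r tu s] inner_w_cmult_left
      by (simp only: inner_w_commute[of a b r ?s] inner_w_commute[of a b u ?s])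
    also have "\<dots> = inner_w a b r r - 2 * t * p + t\<^sup>2 * q"
      unfolding inner_w_diff_left[OF assms(1) r tu r] inner_w_diff_left[OF assms(1) r tu u]
        inner_w_cmult_left p_def q_def inner_w_commute[of a b u r]
      by (simp add: power2_eq_square algebra_simps)
    finally show ?thesis
      by simp
  qed
  \<comment> \<open>The denominator \<open>q + 1\<close> instead of the minimizer's \<open>q\<close> covers the case \<open>q = 0\<close>.\<close>
  define t where "t = p / (q + 1)"
  have p: "p = t * (q + 1)"
    using \<open>0 \<le> q\<close> by (simp add: t_def)
  \<comment> \<open>With \<open>p = t * (q + 1)\<close> the inequality \<open>key\<close> reads
    \<open>2 * t\<^sup>2 * (q + 1) \<le> t\<^sup>2 * q\<close>.\<close>
  have "t\<^sup>2 * (q + 2) \<le> 0"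
    using key[of t] unfolding p by (simp add: power2_eq_square algebra_simps)
  then have "t = 0"
    using \<open>0 \<le> q\<close> by (simp add: mult_le_0_iff)
  then show ?thesis
    using p by (simp add: p_def r_def)
qed

section \<open>Comparison of coefficients and integration of polynomial vectors\<close>

lemma polynomial_eq_0_on_interval:
  fixes c :: "nat \<Rightarrow> real"
  assumes "a < b" "\<And>x. x \<in> {a..b} \<Longrightarrow> (\<Sum>j = 0..<N + 1. c j * x ^ j) = 0" "k \<le> N"
  shows "c k = 0"
proof (rule ccontr)
  assume "c k \<noteq> 0"
  \<comment> \<open>A nonzero coefficient leaves only finitely many roots, whereas the interval is
    infinite because \<open>a < b\<close>.\<close>
  then have "finite {x. (\<Sum>j\<le>N. c j * x ^ j) = 0}"
    unfolding polyfun_finite_roots using assms(3) by blast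
  moreover have "{0..<N + 1} = {..N}"
    by auto
  then have "{a..b} \<subseteq> {x. (\<Sum>j\<le>N. c j * x ^ j) = 0}"
    using assms(2) by auto
  ultimately have "finite {a..b}"
    by (rule finite_subset[rotated])
  then show False
    using assms(1) by (simp add: infinite_Icc)
qed

lemma integral_vec_mult_mat_vec:
  assumes "M \<in> carrier_mat (N + 1) (N + 1)" "n \<le> N"
    and "\<And>t. t \<in> {a..x} \<Longrightarrow> F t = M *\<^sub>v monom_vec N t"
  shows "integral_vec a N F x $ n
    = (\<Sum>j = 0..<N + 1. M $$ (n, j) * integral_vec a N (monom_vec N) x $ j)"
proof -
  have "integral_vec a N F x $ n
      = (\<integral>t. (\<Sum>j = 0..<N + 1. M $$ (n, j) * t ^ j) \<partial>lebesgue_on {a..x})"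
    using assms unfolding integral_vec_def
    by (auto simp: monom_vec_def scalar_prod_def simp del: sum.op_ivl_Suc
        intro!: Bochner_Integration.integral_cong)
  also have "\<dots> = (\<Sum>j = 0..<N + 1. \<integral>t. M $$ (n, j) * t ^ j \<partial>lebesgue_on {a..x})"
    by (intro Bochner_Integration.integral_sum continuous_imp_integrable_real continuous_intros)
  also have "\<dots> = (\<Sum>j = 0..<N + 1. M $$ (n, j) * integral_vec a N (monom_vec N) x $ j)"
    by (intro sum.cong) (auto simp: integral_vec_def monom_vec_def)
  finally show ?thesis .
qed

theorem lemma2:
  fixes a b :: real and N :: nat and M Minv L I :: "real mat"
  assumes "a < b"
    and "M \<in> carrier_mat (N + 1) (N + 1)"
    and "Minv \<in> carrier_mat (N + 1) (N + 1)"
    and "inverts_mat M Minv" and "inverts_mat Minv M"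
    and "\<And>x. x \<in> {a..b} \<Longrightarrow> bessel_vec a b N x = M *\<^sub>v monom_vec N x"
    and "\<And>x. x \<in> {a..b} \<Longrightarrow> monom_vec N x = Minv *\<^sub>v bessel_vec a b N x"
    and "L \<in> carrier_mat (N + 1) (N + 1)"
    and "best_approx_vec a b N (integral_vec a N (monom_vec N)) (\<lambda>x. L *\<^sub>v monom_vec N x)"
    and "I \<in> carrier_mat (N + 1) (N + 1)"
    and "best_approx_vec a b N (integral_vec a N (bessel_vec a b N)) (\<lambda>x. I *\<^sub>v bessel_vec a b N x)"
  shows "I = M * L * Minv"
proof -
  have carr: "I * M \<in> carrier_mat (N + 1) (N + 1)" "M * L \<in> carrier_mat (N + 1) (N + 1)"
    using assms by auto
  have eq: "(I * M) $$ (n, k) = (M * L) $$ (n, k)" if nk: "n \<le> N" "k \<le> N" for n k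
  proof -
    define G where "G j x = integral_vec a N (monom_vec N) x $ j" for j x
    define P where "P j x = (L *\<^sub>v monom_vec N x) $ j" for j x
    define H where "H x = integral_vec a N (bessel_vec a b N) x $ n" for x
    define R where "R x = (I *\<^sub>v bessel_vec a b N x) $ n" for x
    \<comment> \<open>The function \<open>d\<close> plays two roles: as a member of the span it is a
      test function for the residuals, and on \<open>{a..b}\<close> it is itself a combination of
      residuals. Together these give \<open>inner_w a b d d = 0\<close>.\<close>
    define d where "d x = R x - (\<Sum>j = 0..<N + 1. M $$ (n, j) * P j x)" for x
    have GP: "best_approx a b N (G j) (P j)" if "j \<le> N" for j
      using assms(9) that unfolding best_approx_vec_def G_def P_def by blast
    have HR: "best_approx a b N H R"
      using assms(11) nk unfolding best_approx_vec_def H_def R_def by blast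
    have d: "d \<in> bessel_span a b N"
      unfolding d_def using GP HR
      by (intro bessel_span_diff bessel_span_sum) (auto simp: best_approx_def)
    note dL2 = bessel_span_imp_L2w[OF d]
    have GP_L2: "(\<lambda>x. G j x - P j x) \<in> L2w a b" if "j \<le> N" for j
      using GP[OF that] assms(1)
      by (intro L2w_diff) (auto simp: best_approx_def intro: bessel_span_imp_L2w)
    have HR_L2: "(\<lambda>x. H x - R x) \<in> L2w a b"
      using HR assms(1)
      by (intro L2w_diff) (auto simp: best_approx_def intro: bessel_span_imp_L2w)
    have d_eq: "d x = (\<Sum>j = 0..<N + 1. M $$ (n, j) * (G j x - P j x)) - (H x - R x)"
      if "x \<in> {a..b}" for x
    proof -
      \<comment> \<open>For \<open>x\<close> in \<open>{a..b}\<close> the range of integration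
        \<open>{a..x}\<close> stays inside \<open>{a..b}\<close>, where \<open>M\<close> expresses
        the Bessel vector in monomials. The integrals then cancel, leaving only the approximations
        in \<open>d\<close>.\<close>
      have "H x = (\<Sum>j = 0..<N + 1. M $$ (n, j) * G j x)"
        unfolding H_def G_def using assms(6) that
        by (intro integral_vec_mult_mat_vec[OF assms(2) nk(1)]) auto
      then show ?thesis
        unfolding d_def right_diff_distrib sum_subtractf by linarith
    qed
    have "inner_w a b d d
        = inner_w a b (\<lambda>x. (\<Sum>j = 0..<N + 1. M $$ (n, j) * (G j x - P j x)) - (H x - R x)) d"
      by (rule inner_w_cong) (rule d_eq)
    also have "\<dots> = inner_w a b (\<lambda>x. \<Sum>j = 0..<N + 1. M $$ (n, j) * (G j x - P j x)) d
        - inner_w a b (\<lambda>x. H x - R x) d"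
      using GP_L2 by (intro inner_w_diff_left[OF assms(1) _ HR_L2 dL2] L2w_sum[OF assms(1)]) auto
    also have "\<dots> = (\<Sum>j = 0..<N + 1. M $$ (n, j) * inner_w a b (\<lambda>x. G j x - P j x) d)
        - inner_w a b (\<lambda>x. H x - R x) d"
      using GP_L2 by (subst inner_w_sum_left[OF assms(1) _ dL2]) auto
    also have "\<dots> = 0"
      using best_approx_orthogonal[OF assms(1) GP d] best_approx_orthogonal[OF assms(1) HR d]
      by simp
    finally have "inner_w a b d d = 0" .
    then have d0: "d x = 0" if "x \<in> {a..b}" for x
      using inner_w_self_eq_0[OF assms(1) bessel_span_continuous_on[OF d] _ that] by blast
    have "(\<Sum>j = 0..<N + 1. ((I * M) $$ (n, j) - (M * L) $$ (n, j)) * x ^ j) = 0"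
      if x: "x \<in> {a..b}" for x
    proof -
      have X: "monom_vec N x \<in> carrier_vec (N + 1)"
        by (simp add: monom_vec_def)
      have coeffs: "(A *\<^sub>v monom_vec N x) $ n = (\<Sum>j = 0..<N + 1. A $$ (n, j) * x ^ j)"
        if "A \<in> carrier_mat (N + 1) (N + 1)" for A
        using that nk by (auto simp: monom_vec_def scalar_prod_def simp del: sum.op_ivl_Suc)
      \<comment> \<open>Associativity turns both parts of \<open>d x\<close> into polynomials in
        \<open>x\<close>, with coefficients from row \<open>n\<close> of \<open>I * M\<close> and of
        \<open>M * L\<close>.\<close>
      have "R x = ((I * M) *\<^sub>v monom_vec N x) $ n"
        unfolding R_def assms(6)[OF x] using assoc_mult_mat_vec[OF assms(10,2) X] by simp
      moreover have "(\<Sum>j = 0..<N + 1. M $$ (n, j) * P j x) = (M *\<^sub>v (L *\<^sub>v monom_vec N x)) $ n"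
        unfolding P_def using assms(2,8) nk
        by (auto simp: scalar_prod_def simp del: sum.op_ivl_Suc)
      then have "(\<Sum>j = 0..<N + 1. M $$ (n, j) * P j x) = ((M * L) *\<^sub>v monom_vec N x) $ n"
        using assoc_mult_mat_vec[OF assms(2,8) X] by simp
      ultimately show ?thesis
        using d0[OF x] unfolding d_def coeffs[OF carr(1)] coeffs[OF carr(2)]
        by (simp add: left_diff_distrib sum_subtractf del: sum.op_ivl_Suc)
    qed
    from polynomial_eq_0_on_interval[OF assms(1) this nk(2)] show ?thesis
      by simp
  qed
  have IM: "I * M = M * L"
    using carr by (intro eq_matI) (auto simp: eq simp del: index_mult_mat)
  \<comment> \<open>Multiplying \<open>I * M = M * L\<close> by \<open>Minv\<close> on the right
    isolates \<open>I\<close>.\<close>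
  have "I = I * (M * Minv)"
    using assms(2,4,10) unfolding inverts_mat_def by simp
  also have "\<dots> = M * L * Minv"
    using assoc_mult_mat[OF assms(10,2,3)] IM by simp
  finally show ?thesis .
qed

end
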